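(* Let $\Psi$ be a $\mathsf{Max\text{-}2OR}$ instance with $m_1$ 1-clauses and $m_2$ 2-clauses. Then $$\mathrm{val}_\Psi\ \le\ \min\left\{m_1+m_2,\ \frac{m_1+2m_2+\mathrm{bias}(\Psi)}{2}\right\}.$$
   Context: A $\mathsf{Max\text{-}2OR}$ instance $\Psi$ consists of Boolean variables $x_1,\dots,x_n$ and a list of clauses, each being either a 1-clause (a single literal $x_i$ or $\neg x_i$) or a 2-clause (a disjunction of two literals of two distinct variables); clauses with two identical literals are regarded as 1-clauses, and there are no tautological clauses. $\mathrm{val}_\Psi$ is the maximum over all assignments of the number of satisfied clauses. For $r\in\{1,2\}$, $\mathrm{pos}^{(r)}_i(\Psi)$ and $\mathrm{neg}^{(r)}_i(\Psi)$ denote the numbers of $r$-clauses containing the literal $x_i$, respectively $\neg x_i$. The bias is $$\mathrm{bias}(\Psi)=\frac12\sum_{i=1}^n\left|2\,\mathrm{pos}^{(1)}_i(\Psi)+\mathrm{pos}^{(2)}_i(\Psi)-2\,\mathrm{neg}^{(1)}_i(\Psi)-\mathrm{neg}^{(2)}_i(\Psi)\right|.$$ *)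

theory Defs
  imports Complex_Main "HOL-Library.FuncSet"
begin

datatype lit = Pos (var: nat) | Neg (var: nat)

fun lit_true :: "(nat \<Rightarrow> bool) \<Rightarrow> lit \<Rightarrow> bool" where
  "lit_true a (Pos i) = a i"
| "lit_true a (Neg i) = (\<not> a i)"

text \<open>A clause is the set of its literals, read disjunctively; hence a clause with two
  identical literals is a 1-clause. Repeated clauses are kept, since an instance is a list.\<close>

type_synonym clause = "lit set"

definition clause_true :: "(nat \<Rightarrow> bool) \<Rightarrow> clause \<Rightarrow> bool" where
  "clause_true a C \<longleftrightarrow> (\<exists>l\<in>C. lit_true a l)"

text \<open>Injectivity of \<open>var\<close> on a clause says that the two literals of a 2-clause belong to
  distinct variables, which excludes the tautologies \<open>x\<^sub>i \<or> \<not> x\<^sub>i\<close>.\<close>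

definition max_2or_instance :: "nat \<Rightarrow> clause list \<Rightarrow> bool" where
  "max_2or_instance n \<Psi> \<longleftrightarrow>
     (\<forall>C\<in>set \<Psi>. card C \<in> {1, 2} \<and> inj_on var C \<and> var ` C \<subseteq> {1..n})"

definition num_satisfied :: "clause list \<Rightarrow> (nat \<Rightarrow> bool) \<Rightarrow> nat" where
  "num_satisfied \<Psi> a = length (filter (clause_true a) \<Psi>)"

definition max_2or_val :: "nat \<Rightarrow> clause list \<Rightarrow> nat" where
  "max_2or_val n \<Psi> = Max (num_satisfied \<Psi> ` ({1..n} \<rightarrow>\<^sub>E (UNIV :: bool set)))"

definition num_clauses :: "nat \<Rightarrow> clause list \<Rightarrow> nat" where
  "num_clauses r \<Psi> = length (filter (\<lambda>C. card C = r) \<Psi>)"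

definition pos_occ :: "nat \<Rightarrow> nat \<Rightarrow> clause list \<Rightarrow> nat" where
  "pos_occ r i \<Psi> = length (filter (\<lambda>C. card C = r \<and> Pos i \<in> C) \<Psi>)"

definition neg_occ :: "nat \<Rightarrow> nat \<Rightarrow> clause list \<Rightarrow> nat" where
  "neg_occ r i \<Psi> = length (filter (\<lambda>C. card C = r \<and> Neg i \<in> C) \<Psi>)"

definition bias :: "nat \<Rightarrow> clause list \<Rightarrow> real" where
  "bias n \<Psi> = 1 / 2 * (\<Sum>i = 1..n.
     \<bar>2 * real (pos_occ 1 i \<Psi>) + real (pos_occ 2 i \<Psi>)
       - 2 * real (neg_occ 1 i \<Psi>) - real (neg_occ 2 i \<Psi>)\<bar>)"

end

theory Submission
  imports Defs
begin

text \<open>Fix an assignment, put \<open>s\<^sub>i = \<plusminus>1\<close> according to the truth value of \<open>x\<^sub>i\<close>, and let \<open>d\<^sub>i\<close> be the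
  signed quantity whose absolute value enters the bias. Then \<open>\<Sum>\<^sub>i s\<^sub>i d\<^sub>i\<close> splits into contributions
  of the clauses: true minus false literals, doubled for a 1-clause. Four times the truth value of
  a 1-clause is 2 plus its contribution, and four times the truth value of a 2-clause is at most 4
  plus its contribution. Summing over the clauses and using \<open>s\<^sub>i d\<^sub>i \<le> \<bar>d\<^sub>i\<bar>\<close> gives the second bound.\<close>

definition sgn_of :: "bool \<Rightarrow> real" where
  "sgn_of b = (if b then 1 else - 1)"

definition var_bias :: "nat \<Rightarrow> clause list \<Rightarrow> real" where
  "var_bias i \<Psi> = 2 * real (pos_occ 1 i \<Psi>) + real (pos_occ 2 i \<Psi>)
     - 2 * real (neg_occ 1 i \<Psi>) - real (neg_occ 2 i \<Psi>)"

lemma bias_eq: "bias n \<Psi> = (\<Sum>i = 1..n. \<bar>var_bias i \<Psi>\<bar>) / 2"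
  by (simp add: bias_def var_bias_def)

lemma var_bias_Nil [simp]: "var_bias i [] = 0"
  by (simp add: var_bias_def pos_occ_def neg_occ_def)

text \<open>Additivity holds because no absolute value has been taken yet; it is what allows the
  signed sum to be split clause by clause.\<close>

lemma var_bias_Cons: "var_bias i (C # \<Psi>) = var_bias i [C] + var_bias i \<Psi>"
  by (simp add: var_bias_def pos_occ_def neg_occ_def)

text \<open>Only the index \<open>var l\<close> contributes, and there the sign of the variable
  times the sign of the literal is 1 exactly when \<open>l\<close> is true.\<close>

lemma sum_literal_sign:
  assumes "var l \<in> {1..n}"
  shows "(\<Sum>i = 1..n. sgn_of (a i) * (of_bool (Pos i = l) - of_bool (Neg i = l)))
    = sgn_of (lit_true a l)"
proof -
  have "(\<Sum>i = 1..n. sgn_of (a i) * (of_bool (Pos i = l) - of_bool (Neg i = l)))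
      = (\<Sum>i = 1..n. if i = var l then sgn_of (lit_true a l) else 0)"
    by (rule sum.cong) (cases l; auto simp: sgn_of_def)+
  then show ?thesis
    using assms by simp
qed

text \<open>For a 1-clause both sides agree: 4 or 0. For a 2-clause with 2, 1 or 0 true literals the
  right side is 6, 4 or 2 against 4, 4 or 0 on the left, so it is tight when exactly one literal is
  true.\<close>

lemma clause_true_le:
  assumes "card C \<in> {1, 2}" and "var ` C \<subseteq> {1..n}"
  shows "4 * of_bool (clause_true a C)
    \<le> 2 * of_bool (card C = 1) + 4 * of_bool (card C = 2)
      + (\<Sum>i = 1..n. sgn_of (a i) * var_bias i [C])"
  using assms(1)
proof (elim insertE emptyE)
  assume "card C = 1"
  then obtain l where C: "C = {l}"
    by (auto simp: card_1_singleton_iff)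
  have "var_bias i [C] = 2 * (of_bool (Pos i = l) - of_bool (Neg i = l))" for i
    by (simp add: var_bias_def pos_occ_def neg_occ_def C)
  then have "(\<Sum>i = 1..n. sgn_of (a i) * var_bias i [C])
      = 2 * (\<Sum>i = 1..n. sgn_of (a i) * (of_bool (Pos i = l) - of_bool (Neg i = l)))"
    by (simp add: sum_distrib_left mult.left_commute right_diff_distrib)
  also have "\<dots> = 2 * sgn_of (lit_true a l)"
    using assms(2) C by (subst sum_literal_sign) auto
  finally show ?thesis
    by (simp add: C clause_true_def sgn_of_def)
next
  assume card: "card C = 2"
  then obtain l k where C: "C = {l, k}" and "l \<noteq> k"
    by (auto simp: card_2_iff)
  \<comment> \<open>As \<open>l \<noteq> k\<close>, at most one of the two equations with
    \<open>Pos i\<close> holds, so the indicator of \<open>Pos i \<in> C\<close> is their sum;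
    likewise for \<open>Neg i\<close>.\<close>
  then have "var_bias i [C] = (of_bool (Pos i = l) - of_bool (Neg i = l))
      + (of_bool (Pos i = k) - of_bool (Neg i = k))" for i
    by (auto simp: var_bias_def pos_occ_def neg_occ_def)
  then have "(\<Sum>i = 1..n. sgn_of (a i) * var_bias i [C])
      = (\<Sum>i = 1..n. sgn_of (a i) * (of_bool (Pos i = l) - of_bool (Neg i = l)))
        + (\<Sum>i = 1..n. sgn_of (a i) * (of_bool (Pos i = k) - of_bool (Neg i = k)))"
    by (simp add: sum.distrib distrib_left)
  also have "\<dots> = sgn_of (lit_true a l) + sgn_of (lit_true a k)"
    using assms(2) C by (subst (1 2) sum_literal_sign) auto
  finally have "(\<Sum>i = 1..n. sgn_of (a i) * var_bias i [C])
      = sgn_of (lit_true a l) + sgn_of (lit_true a k)" .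
  then show ?thesis
    using card by (simp add: C clause_true_def sgn_of_def)
qed

text \<open>Both sides are additive in the clause list, so the bounds for single clauses add
  up.\<close>

lemma num_satisfied_le_signed:
  assumes "max_2or_instance n \<Psi>"
  shows "4 * real (num_satisfied \<Psi> a)
    \<le> 2 * real (num_clauses 1 \<Psi>) + 4 * real (num_clauses 2 \<Psi>)
      + (\<Sum>i = 1..n. sgn_of (a i) * var_bias i \<Psi>)"
  using assms
proof (induction \<Psi>)
  case Nil
  show ?case
    by (simp add: num_satisfied_def)
next
  case (Cons C \<Psi>)
  have "(\<Sum>i = 1..n. sgn_of (a i) * var_bias i (C # \<Psi>))
      = (\<Sum>i = 1..n. sgn_of (a i) * var_bias i [C])
        + (\<Sum>i = 1..n. sgn_of (a i) * var_bias i \<Psi>)"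
    by (subst var_bias_Cons) (simp add: distrib_left sum.distrib)
  moreover have "real (num_satisfied (C # \<Psi>) a)
      = of_bool (clause_true a C) + real (num_satisfied \<Psi> a)"
    by (simp add: num_satisfied_def)
  moreover have "real (num_clauses r (C # \<Psi>)) = of_bool (card C = r) + real (num_clauses r \<Psi>)" for r
    by (simp add: num_clauses_def)
  moreover have "max_2or_instance n \<Psi>" "card C \<in> {1, 2}" "var ` C \<subseteq> {1..n}"
    using Cons.prems by (auto simp: max_2or_instance_def)
  ultimately show ?case
    using Cons.IH clause_true_le[of C n a] by simp
qed

lemma num_satisfied_le_bias:
  assumes "max_2or_instance n \<Psi>"
  shows "real (num_satisfied \<Psi> a)
    \<le> (real (num_clauses 1 \<Psi>) + 2 * real (num_clauses 2 \<Psi>) + bias n \<Psi>) / 2"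
proof -
  have "(\<Sum>i = 1..n. sgn_of (a i) * var_bias i \<Psi>) \<le> (\<Sum>i = 1..n. \<bar>var_bias i \<Psi>\<bar>)"
    by (rule sum_mono) (auto simp: sgn_of_def)
  \<comment> \<open>The sum of absolute values is twice \<open>bias n \<Psi>\<close>; dividing by 4
    gives the claim.\<close>
  then show ?thesis
    using num_satisfied_le_signed[OF assms, of a] by (simp add: bias_eq)
qed

lemma length_eq_num_clauses:
  assumes "max_2or_instance n \<Psi>"
  shows "length \<Psi> = num_clauses 1 \<Psi> + num_clauses 2 \<Psi>"
  using assms by (induction \<Psi>) (auto simp: max_2or_instance_def num_clauses_def)

text \<open>A maximum over a finite nonempty set is attained, so bounds valid for every assignment
  carry over to \<open>max_2or_val\<close>.\<close>

lemma max_2or_val_attained: "\<exists>a. max_2or_val n \<Psi> = num_satisfied \<Psi> a"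
proof -
  have "finite ({1..n} \<rightarrow>\<^sub>E (UNIV :: bool set))"
    by (simp add: finite_PiE)
  then have "max_2or_val n \<Psi> \<in> num_satisfied \<Psi> ` ({1..n} \<rightarrow>\<^sub>E UNIV)"
    unfolding max_2or_val_def by (intro Max_in) (auto simp: PiE_eq_empty_iff)
  then show ?thesis
    by blast
qed

theorem lemma3p6:
  fixes n m1 m2 :: nat and \<Psi> :: "clause list"
  assumes "max_2or_instance n \<Psi>"
    and "m1 = num_clauses 1 \<Psi>"
    and "m2 = num_clauses 2 \<Psi>"
  shows "real (max_2or_val n \<Psi>)
    \<le> min (real m1 + real m2) ((real m1 + 2 * real m2 + bias n \<Psi>) / 2)"
proof -
  obtain a where a: "max_2or_val n \<Psi> = num_satisfied \<Psi> a"
    using max_2or_val_attained by blast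
  have "num_satisfied \<Psi> a \<le> m1 + m2"
    using length_eq_num_clauses[OF assms(1)] assms(2,3)
    by (metis length_filter_le num_satisfied_def)
  then show ?thesis
    using num_satisfied_le_bias[OF assms(1), of a] assms(2,3) by (simp add: a)
qed

end
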